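(* Let $\mathcal E\subset\mathbf P^6$ be the Klein--Vélu septic over the field $\mathbf C(\psi,\upsilon)$, where $\psi^7=\upsilon^4(\upsilon-1)$, and let $g_1,g_2,g_3$ be the three roots, in an algebraic closure of $\mathbf C(\psi,\upsilon)$, of \[ T^3+T^2-\frac{\upsilon^2-1}{\upsilon}T+\frac{(\upsilon-1)^2}{\upsilon}=0. \] Then the three non-trivial points of order $2$ on $\mathcal E$ are the points $(x_0:x_1:x_2:x_3:x_4:x_5:x_6)$ equal to \[ \left( g_i+1:\frac{\psi^2}{\upsilon}: \frac{\upsilon-(g_i+1)}{g_i}\,\frac{\psi}{\upsilon}: \frac{\upsilon-(g_i+1)}{g_i^2}\,\frac{\psi^4}{\upsilon^3}: \frac{\upsilon-(g_i+1)}{g_i^2}\,\frac{\psi^4}{\upsilon^3}: \frac{\upsilon-(g_i+1)}{g_i}\,\frac{\psi}{\upsilon}: \frac{\psi^2}{\upsilon} \right), \] for $i=1,2,3$.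
   Context: Let $\mathbf C(\psi,\upsilon)$ be the function field of the curve $\psi^7=\upsilon^4(\upsilon-1)$. The Klein--Vélu septic $\mathcal E\subset\mathbf P^6$, with coordinates $x_i$ indexed by $i\in\mathbf Z/7\mathbf Z$, is the elliptic normal curve of degree $7$ over this field defined by the fourteen quadrics \[ \psi\upsilon^{3}x_i^{2}+\upsilon^{4}x_{i+3}x_{i-3}-\psi^{6}x_{i+2}x_{i-2}=0,\qquad \psi\upsilon^2x_i^2+\upsilon^2x_{i+3}x_{i-3}-\psi^4x_{i+1}x_{i-1}=0\qquad(i\in\mathbf Z/7\mathbf Z). \] Its origin (zero of the group law) is $O=(0:a_1:a_2:a_3:-a_3:-a_2:-a_1)$ where $a_1:a_2:a_3=1:-\upsilon/\psi:\psi^2/\upsilon$ (so that $\psi=-a_2a_3/a_1^2$, $\upsilon=a_2^2a_3/a_1^3$). The inversion $[-1]$ is $(x_0:x_1:x_2:x_3:x_4:x_5:x_6)\mapsto(x_0:x_6:x_5:x_4:x_3:x_2:x_1)$. *)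

theory Defs
  imports
    "HOL-Analysis.Analysis"
    "HOL-Computational_Algebra.Computational_Algebra"
    "HOL-Algebra.Multiplicative_Group"
begin

text \<open>
  A polynomial in \<open>\<complex>[U][Y]\<close>, given as \<^typ>\<open>complex poly poly\<close>, is evaluated at
  \<open>U = \<upsilon>\<close>, \<open>Y = \<psi>\<close>, where \<open>\<iota>\<close> embeds \<open>\<complex>\<close> into the ambient field.
\<close>

definition eval2 :: "(complex \<Rightarrow> 'k::field) \<Rightarrow> 'k \<Rightarrow> 'k \<Rightarrow> complex poly poly \<Rightarrow> 'k" where
  "eval2 \<iota> \<psi> \<upsilon> P = poly (map_poly (\<lambda>p. poly (map_poly \<iota> p) \<upsilon>) P) \<psi>"

definition curve_poly :: "complex poly poly" where
  "curve_poly = [:0, 1:]^7 - [: [:0, 1:]^4 * ([:0, 1:] - 1) :]"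

definition field_embedding :: "(complex \<Rightarrow> 'k::field) \<Rightarrow> bool" where
  "field_embedding \<iota> \<longleftrightarrow> \<iota> 1 = 1 \<and>
     (\<forall>x y. \<iota> (x + y) = \<iota> x + \<iota> y) \<and> (\<forall>x y. \<iota> (x * y) = \<iota> x * \<iota> y)"

definition generated_field :: "(complex \<Rightarrow> 'k::field) \<Rightarrow> 'k \<Rightarrow> 'k \<Rightarrow> 'k set" where
  "generated_field \<iota> \<psi> \<upsilon> = {eval2 \<iota> \<psi> \<upsilon> P / eval2 \<iota> \<psi> \<upsilon> Q | P Q. eval2 \<iota> \<psi> \<upsilon> Q \<noteq> 0}"

text \<open>
  The second conjunct identifies \<open>\<complex>[\<psi>, \<upsilon>]\<close> with \<open>\<complex>[Y, U] / (Y\<^sup>7 - U\<^sup>4 (U - 1))\<close>, the coordinate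
  ring of the affine curve, so that \<^const>\<open>generated_field\<close> is its function field
  \<open>\<complex>(\<psi>, \<upsilon>)\<close>.  The third conjunct, together with the class constraint, makes the whole type \<open>'k\<close> an
  algebraic closure of that field.
\<close>

definition closure_of_function_field ::
    "(complex \<Rightarrow> 'k::alg_closed_field) \<Rightarrow> 'k \<Rightarrow> 'k \<Rightarrow> bool" where
  "closure_of_function_field \<iota> \<psi> \<upsilon> \<longleftrightarrow>
     field_embedding \<iota> \<and>
     (\<forall>P. eval2 \<iota> \<psi> \<upsilon> P = 0 \<longleftrightarrow> curve_poly dvd P) \<and>
     (\<forall>z. \<exists>p. p \<noteq> 0 \<and> (\<forall>n. poly.coeff p n \<in> generated_field \<iota> \<psi> \<upsilon>) \<and> poly p z = 0)"

text \<open>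
  Homogeneous coordinates are indexed by the numeral type \<open>7\<close>, whose ring structure is
  \<open>\<int>/7\<int>\<close>.  A point of \<open>\<P>\<^sup>6\<close> is the set of its coordinate vectors, a punctured line.
\<close>

definition proj_pt :: "'k::field ^ 7 \<Rightarrow> ('k ^ 7) set" where
  "proj_pt x = {c *s x | c. c \<noteq> 0}"

definition vec7 :: "'k \<Rightarrow> 'k \<Rightarrow> 'k \<Rightarrow> 'k \<Rightarrow> 'k \<Rightarrow> 'k \<Rightarrow> 'k \<Rightarrow> 'k ^ 7" where
  "vec7 x0 x1 x2 x3 x4 x5 x6 = (\<chi> i.
     if i = 0 then x0 else if i = 1 then x1 else if i = 2 then x2 else if i = 3 then x3
     else if i = 4 then x4 else if i = 5 then x5 else x6)"

definition klein_velu :: "'k::field \<Rightarrow> 'k \<Rightarrow> ('k ^ 7) set set" where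
  "klein_velu \<psi> \<upsilon> = {proj_pt x | x. x \<noteq> 0 \<and>
     (\<forall>i. \<psi> * \<upsilon>^3 * (x $ i)^2 + \<upsilon>^4 * x $ (i + 3) * x $ (i - 3)
            - \<psi>^6 * x $ (i + 2) * x $ (i - 2) = 0) \<and>
     (\<forall>i. \<psi> * \<upsilon>^2 * (x $ i)^2 + \<upsilon>^2 * x $ (i + 3) * x $ (i - 3)
            - \<psi>^4 * x $ (i + 1) * x $ (i - 1) = 0)}"

definition kv_origin :: "'k::field \<Rightarrow> 'k \<Rightarrow> ('k ^ 7) set" where
  "kv_origin \<psi> \<upsilon> =
     (let a1 = 1; a2 = - (\<upsilon> / \<psi>); a3 = \<psi>^2 / \<upsilon>
      in proj_pt (vec7 0 a1 a2 a3 (- a3) (- a2) (- a1)))"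

definition kv_neg :: "('k::field ^ 7) set \<Rightarrow> ('k ^ 7) set" where
  "kv_neg P =
     (\<lambda>x. vec7 (x $ 0) (x $ 6) (x $ 5) (x $ 4) (x $ 3) (x $ 2) (x $ 1)) ` P"

text \<open>
  Since an algebraically closed field is infinite, polynomials in the coordinates of a pair of
  vectors may be identified with the functions they define, and bihomogeneity of bidegree
  \<open>(d, e)\<close> with the corresponding functional equation.
\<close>

inductive poly_fun2 :: "('k::field ^ 7 \<Rightarrow> 'k ^ 7 \<Rightarrow> 'k) \<Rightarrow> bool" where
  const: "poly_fun2 (\<lambda>x y. c)"
| left: "poly_fun2 (\<lambda>x y. x $ i)"
| right: "poly_fun2 (\<lambda>x y. y $ i)"
| add: "poly_fun2 f \<Longrightarrow> poly_fun2 g \<Longrightarrow> poly_fun2 (\<lambda>x y. f x y + g x y)"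
| mult: "poly_fun2 f \<Longrightarrow> poly_fun2 g \<Longrightarrow> poly_fun2 (\<lambda>x y. f x y * g x y)"

definition biform :: "nat \<Rightarrow> nat \<Rightarrow> ('k::field ^ 7 \<Rightarrow> 'k ^ 7 \<Rightarrow> 'k) \<Rightarrow> bool" where
  "biform d e f \<longleftrightarrow> poly_fun2 f \<and>
     (\<forall>s t x y. f (s *s x) (t *s y) = s ^ d * t ^ e * f x y)"

text \<open>
  A regular map \<open>E \<times> E \<rightarrow> \<P>\<^sup>6\<close> for an irreducible projective curve \<open>E\<close>: near every pair of
  points it is given by seven forms of one bidegree without common zero there.  By
  irreducibility of \<open>E \<times> E\<close> such forms give the map wherever they do not all vanish.
\<close>

definition regular_op ::
    "('k::field ^ 7) set set \<Rightarrow> (('k ^ 7) set \<Rightarrow> ('k ^ 7) set \<Rightarrow> ('k ^ 7) set) \<Rightarrow> bool" where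
  "regular_op E m \<longleftrightarrow> (\<forall>P0\<in>E. \<forall>Q0\<in>E. \<exists>d e F.
     (\<forall>k. biform d e (F k)) \<and>
     (\<forall>x\<in>P0. \<forall>y\<in>Q0. (\<chi> k. F k x y) \<noteq> 0) \<and>
     (\<forall>P\<in>E. \<forall>Q\<in>E. \<forall>x\<in>P. \<forall>y\<in>Q.
        (\<chi> k. F k x y) \<noteq> 0 \<longrightarrow> m P Q = proj_pt (\<chi> k. F k x y)))"

text \<open>
  The group law of the elliptic curve: by rigidity a smooth projective curve of genus one carries
  exactly one algebraic group structure with a prescribed neutral element.  The last
  conjunct records that its inversion is the reversal of coordinates.
\<close>

definition kv_group_law :: "'k::field \<Rightarrow> 'k \<Rightarrow> ('k ^ 7) set monoid \<Rightarrow> bool" where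
  "kv_group_law \<psi> \<upsilon> G \<longleftrightarrow>
     comm_group G \<and> carrier G = klein_velu \<psi> \<upsilon> \<and> \<one>\<^bsub>G\<^esub> = kv_origin \<psi> \<upsilon> \<and>
     regular_op (carrier G) (\<lambda>P Q. P \<otimes>\<^bsub>G\<^esub> Q) \<and>
     (\<forall>P\<in>carrier G. inv\<^bsub>G\<^esub> P = kv_neg P)"

definition kv_point :: "'k::field \<Rightarrow> 'k \<Rightarrow> 'k \<Rightarrow> ('k ^ 7) set" where
  "kv_point \<psi> \<upsilon> g =
     (let b1 = \<psi>^2 / \<upsilon>;
          b2 = (\<upsilon> - (g + 1)) / g * (\<psi> / \<upsilon>);
          b3 = (\<upsilon> - (g + 1)) / g^2 * (\<psi>^4 / \<upsilon>^3)
      in proj_pt (vec7 (g + 1) b1 b2 b3 b3 b2 b1))"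

end

theory Submission
  imports Defs
begin

text \<open>
  Inversion reverses the coordinates, so a point \<open>P \<noteq> O\<close> has order 2 iff its coordinate vectors are
  eigenvectors of the reversal, for the eigenvalue \<open>1\<close> or \<open>-1\<close>. The quadrics leave only \<open>O\<close> among the
  antisymmetric vectors. A symmetric vector can be scaled to have \<open>x\<^sub>1 = \<psi>\<^sup>2 / \<upsilon>\<close>; writing
  \<open>x\<^sub>2 = b \<psi> / \<upsilon>\<close>, the quadrics make every coordinate a function of \<open>g = (\<upsilon> - 1) / (b + 1)\<close> and
  become equivalent to the cubic equation for \<open>g\<close>. The discriminant of the cubic is
  \<open>4 (\<upsilon> - 1)\<^sup>3 (\<upsilon>\<^sup>3 - 8 \<upsilon>\<^sup>2 + 5 \<upsilon> + 1) / \<upsilon>\<^sup>3\<close>, which is nonzero as \<open>\<upsilon>\<close> is transcendental over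
  \<open>\<complex>\<close>.
\<close>

no_notation fps_nth (infixl \<open>$\<close> 75)

section \<open>Coordinates on the projective space\<close>

lemma forall_7: "(\<forall>i::7. P i) \<longleftrightarrow> P 0 \<and> P 1 \<and> P 2 \<and> P 3 \<and> P 4 \<and> P 5 \<and> P 6"
proof -
  have "{0, 1, 2, 3, 4, 5, 6} = (UNIV :: 7 set)"
    by (rule card_seteq) simp_all
  then have "(\<forall>i::7. P i) \<longleftrightarrow> (\<forall>i\<in>{0, 1, 2, 3, 4, 5, 6}. P i)"
    by (metis UNIV_I)
  then show ?thesis
    by simp
qed

text \<open>For \<open>i\<close> from 0 to 6 the shifted indices in the quadrics range from -3 to 9.
  These rewrites return them to the representatives known to \<open>vec7_nth\<close>.\<close>

lemma residues_7 [simp]: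
  "(7::7) = 0" "(8::7) = 1" "(9::7) = 2" "(- 1::7) = 6" "(- 2::7) = 5" "(- 3::7) = 4"
  by simp_all

lemma vec7_nth [simp]:
  "vec7 x0 x1 x2 x3 x4 x5 x6 $ 0 = x0" "vec7 x0 x1 x2 x3 x4 x5 x6 $ 1 = x1"
  "vec7 x0 x1 x2 x3 x4 x5 x6 $ 2 = x2" "vec7 x0 x1 x2 x3 x4 x5 x6 $ 3 = x3"
  "vec7 x0 x1 x2 x3 x4 x5 x6 $ 4 = x4" "vec7 x0 x1 x2 x3 x4 x5 x6 $ 5 = x5"
  "vec7 x0 x1 x2 x3 x4 x5 x6 $ 6 = x6"
  by (simp_all add: vec7_def)

lemma vec7_cases:
  obtains x0 x1 x2 x3 x4 x5 x6 where "x = vec7 x0 x1 x2 x3 x4 x5 x6"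
proof
  show "x = vec7 (x $ 0) (x $ 1) (x $ 2) (x $ 3) (x $ 4) (x $ 5) (x $ 6)"
    by (simp add: vec_eq_iff forall_7)
qed

lemma vec7_eq_iff:
  "vec7 x0 x1 x2 x3 x4 x5 x6 = vec7 y0 y1 y2 y3 y4 y5 y6 \<longleftrightarrow>
     x0 = y0 \<and> x1 = y1 \<and> x2 = y2 \<and> x3 = y3 \<and> x4 = y4 \<and> x5 = y5 \<and> x6 = y6"
  by (simp add: vec_eq_iff forall_7)

lemma vec7_eq_0_iff:
  "vec7 x0 x1 x2 x3 x4 x5 x6 = 0 \<longleftrightarrow>
     x0 = 0 \<and> x1 = 0 \<and> x2 = 0 \<and> x3 = 0 \<and> x4 = 0 \<and> x5 = 0 \<and> x6 = 0"
  by (simp add: vec_eq_iff forall_7)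

lemma smult_vec7:
  "c *s vec7 x0 x1 x2 x3 x4 x5 x6 =
     vec7 (c * x0) (c * x1) (c * x2) (c * x3) (c * x4) (c * x5) (c * x6)"
  by (simp add: vec_eq_iff forall_7)

lemma proj_pt_self: "x \<in> proj_pt x"
  by (auto simp: proj_pt_def intro!: exI[of _ 1])

lemma proj_pt_eq_iff: "proj_pt x = proj_pt y \<longleftrightarrow> (\<exists>c. c \<noteq> 0 \<and> x = c *s y)"
proof
  assume "proj_pt x = proj_pt y"
  then have "x \<in> proj_pt y"
    using proj_pt_self by blast
  then show "\<exists>c. c \<noteq> 0 \<and> x = c *s y"
    by (auto simp: proj_pt_def)
next
  assume "\<exists>c. c \<noteq> 0 \<and> x = c *s y"
  then obtain c where c: "c \<noteq> 0" "x = c *s y"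
    by blast
  have "d *s y \<in> {e *s x | e. e \<noteq> 0}" if "d \<noteq> 0" for d
    using that c by (auto intro!: exI[of _ "d / c"])
  then show "proj_pt x = proj_pt y"
    using c by (auto simp: proj_pt_def)
qed

text \<open>The linear lift of \<open>kv_neg\<close> to coordinate vectors, so that fixed points
  become eigenvectors.\<close>

definition reverse7 :: "'k ^ 7 \<Rightarrow> 'k ^ 7" where
  "reverse7 x = vec7 (x $ 0) (x $ 6) (x $ 5) (x $ 4) (x $ 3) (x $ 2) (x $ 1)"

lemma reverse7_vec7 [simp]:
  "reverse7 (vec7 x0 x1 x2 x3 x4 x5 x6) = vec7 x0 x6 x5 x4 x3 x2 x1"
  by (simp add: reverse7_def)

lemma reverse7_smult: "reverse7 (c *s x) = c *s reverse7 x"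
  by (simp add: reverse7_def smult_vec7)

lemma reverse7_reverse7: "reverse7 (reverse7 x) = x"
  by (cases x rule: vec7_cases) simp

lemma kv_neg_proj_pt: "kv_neg (proj_pt x) = proj_pt (reverse7 x)"
proof -
  have "kv_neg (proj_pt x) = reverse7 ` proj_pt x"
    by (simp add: kv_neg_def reverse7_def)
  also have "\<dots> = {reverse7 (c *s x) | c. c \<noteq> 0}"
    by (auto simp: proj_pt_def)
  finally show ?thesis
    by (simp add: proj_pt_def reverse7_smult)
qed

text \<open>The membership condition of \<open>klein_velu\<close>, stated for a single
  representative.\<close>

definition kv_quadrics :: "'k::field \<Rightarrow> 'k \<Rightarrow> 'k ^ 7 \<Rightarrow> bool" where
  "kv_quadrics \<psi> \<upsilon> x \<longleftrightarrow>
     (\<forall>i. \<psi> * \<upsilon>^3 * (x $ i)^2 + \<upsilon>^4 * x $ (i + 3) * x $ (i - 3)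
            - \<psi>^6 * x $ (i + 2) * x $ (i - 2) = 0) \<and>
     (\<forall>i. \<psi> * \<upsilon>^2 * (x $ i)^2 + \<upsilon>^2 * x $ (i + 3) * x $ (i - 3)
            - \<psi>^4 * x $ (i + 1) * x $ (i - 1) = 0)"

lemma klein_velu_eq: "klein_velu \<psi> \<upsilon> = {proj_pt x | x. x \<noteq> 0 \<and> kv_quadrics \<psi> \<upsilon> x}"
  by (simp add: klein_velu_def kv_quadrics_def)

lemma kv_quadrics_smult:
  fixes \<psi> \<upsilon> :: "'k::field"
  assumes "kv_quadrics \<psi> \<upsilon> x"
  shows "kv_quadrics \<psi> \<upsilon> (c *s x)"
proof -
  have scale: "\<alpha> * (c * p)^2 + \<beta> * (c * q) * (c * r) - \<gamma> * (c * s) * (c * t) =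
      c^2 * (\<alpha> * p^2 + \<beta> * q * r - \<gamma> * s * t)" for \<alpha> \<beta> \<gamma> p q r s t :: 'k
    by Groebner_Basis.algebra
  show ?thesis
    using assms by (simp add: kv_quadrics_def scale)
qed

section \<open>Points fixed by the inversion\<close>

text \<open>These are the quadrics of both families at \<open>i = 0\<close> and
  \<open>i = 1\<close>; they suffice to determine the antisymmetric point.\<close>

lemma kv_quadrics_skew:
  fixes \<psi> \<upsilon> :: "'k::field"
  assumes "kv_quadrics \<psi> \<upsilon> (vec7 0 x1 x2 x3 (- x3) (- x2) (- x1))"
  shows "\<upsilon>^2 * x3^2 = \<psi>^4 * x1^2" "\<upsilon>^4 * x3^2 = \<psi>^6 * x2^2"
    "\<psi> * \<upsilon>^2 * x1^2 + \<upsilon>^2 * x3 * x2 = 0"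
    "\<psi> * \<upsilon>^3 * x1^2 + \<upsilon>^4 * x3 * x2 + \<psi>^6 * x3 * x1 = 0"
  using assms unfolding kv_quadrics_def forall_7 by (simp_all add: power2_eq_square mult.assoc)

text \<open>On symmetric vectors the quadrics at \<open>i\<close> and \<open>- i\<close> coincide,
  which leaves both families at \<open>i = 0, 1, 2, 3\<close>.\<close>

lemma kv_quadrics_symmetric_iff:
  fixes \<psi> \<upsilon> :: "'k::field"
  shows "kv_quadrics \<psi> \<upsilon> (vec7 x0 x1 x2 x3 x3 x2 x1) \<longleftrightarrow>
    \<psi> * \<upsilon>^3 * x0^2 + \<upsilon>^4 * x3^2 - \<psi>^6 * x2^2 = 0 \<and>
    \<psi> * \<upsilon>^2 * x0^2 + \<upsilon>^2 * x3^2 - \<psi>^4 * x1^2 = 0 \<and>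
    \<psi> * \<upsilon>^3 * x1^2 + \<upsilon>^4 * x2 * x3 - \<psi>^6 * x1 * x3 = 0 \<and>
    \<psi> * \<upsilon>^2 * x1^2 + \<upsilon>^2 * x2 * x3 - \<psi>^4 * x0 * x2 = 0 \<and>
    \<psi> * \<upsilon>^3 * x2^2 + \<upsilon>^4 * x1 * x2 - \<psi>^6 * x0 * x3 = 0 \<and>
    \<psi> * \<upsilon>^2 * x2^2 + \<upsilon>^2 * x1 * x2 - \<psi>^4 * x1 * x3 = 0 \<and>
    \<psi> * \<upsilon>^3 * x3^2 + \<upsilon>^4 * x0 * x1 - \<psi>^6 * x1 * x2 = 0 \<and>
    \<psi> * \<upsilon>^2 * x3^2 + \<upsilon>^2 * x0 * x1 - \<psi>^4 * x2 * x3 = 0"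
  unfolding kv_quadrics_def forall_7 by (simp add: power2_eq_square mult_ac) blast

text \<open>
  With \<open>x\<^sub>1\<close> scaled to \<open>\<psi>\<^sup>2 / \<upsilon>\<close> and suitable units extracted from \<open>x\<^sub>2\<close> and \<open>x\<^sub>3\<close>, the equation of the
  modular curve eliminates \<open>\<psi>\<close> from the quadrics.
\<close>

lemma kv_quadrics_normalised_iff:
  fixes \<psi> \<upsilon> :: "'k::field"
  assumes curve: "\<psi>^7 = \<upsilon>^4 * (\<upsilon> - 1)" and nz: "\<psi> \<noteq> 0" "\<upsilon> \<noteq> 0"
  shows "(let x1 = \<psi>^2 / \<upsilon>; x2 = b * (\<psi> / \<upsilon>); x3 = c * (\<psi>^4 / \<upsilon>^3)
          in kv_quadrics \<psi> \<upsilon> (vec7 a x1 x2 x3 x3 x2 x1)) \<longleftrightarrow>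
    \<upsilon> * a^2 + (\<upsilon> - 1) * c^2 - (\<upsilon> - 1) * b^2 = 0 \<and>
    \<upsilon>^2 * a^2 + (\<upsilon> - 1) * c^2 - \<upsilon>^2 * (\<upsilon> - 1) = 0 \<and>
    \<upsilon> + b * c - (\<upsilon> - 1) * c = 0 \<and>
    \<upsilon>^2 + b * c - \<upsilon> * a * b = 0 \<and>
    b^2 + \<upsilon> * b - (\<upsilon> - 1) * a * c = 0 \<and>
    b^2 + b - (\<upsilon> - 1) * c = 0 \<and>
    (\<upsilon> - 1) * c^2 + \<upsilon>^2 * a - \<upsilon> * (\<upsilon> - 1) * b = 0 \<and>
    (\<upsilon> - 1) * c^2 + \<upsilon> * a - (\<upsilon> - 1) * b * c = 0"
proof -
  \<comment> \<open>A polynomial stand-in for the inverse of \<upsilon>: with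
    \<open>i * \<upsilon> = 1\<close> the identities below are free of division.\<close>
  define i where "i = 1 / \<upsilon>"
  have i: "i * \<upsilon> = 1" and inz: "i \<noteq> 0"
    using nz by (auto simp: i_def)
  define x1 x2 x3 where "x1 = \<psi>^2 * i" and "x2 = b * (\<psi> * i)" and "x3 = c * (\<psi>^4 * i^3)"
  note x = x1_def x2_def x3_def
  \<comment> \<open>Each quadric is a monomial unit in \<psi>, \<upsilon> and \<open>i\<close> times
    its normalised form; cancelling the units gives the equivalence.\<close>
  have
    "\<psi> * \<upsilon>^3 * a^2 + \<upsilon>^4 * x3^2 - \<psi>^6 * x2^2 =
       \<psi> * \<upsilon>^2 * (\<upsilon> * a^2 + (\<upsilon> - 1) * c^2 - (\<upsilon> - 1) * b^2)"
    "\<psi> * \<upsilon>^2 * a^2 + \<upsilon>^2 * x3^2 - \<psi>^4 * x1^2 =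
       \<psi> * (\<upsilon>^2 * a^2 + (\<upsilon> - 1) * c^2 - \<upsilon>^2 * (\<upsilon> - 1))"
    "\<psi> * \<upsilon>^3 * x1^2 + \<upsilon>^4 * x2 * x3 - \<psi>^6 * x1 * x3 =
       \<psi>^5 * (\<upsilon> + b * c - (\<upsilon> - 1) * c)"
    "\<psi> * \<upsilon>^2 * x1^2 + \<upsilon>^2 * x2 * x3 - \<psi>^4 * a * x2 =
       \<psi>^5 * i^2 * (\<upsilon>^2 + b * c - \<upsilon> * a * b)"
    "\<psi> * \<upsilon>^3 * x2^2 + \<upsilon>^4 * x1 * x2 - \<psi>^6 * a * x3 =
       \<psi>^3 * \<upsilon> * (b^2 + \<upsilon> * b - (\<upsilon> - 1) * a * c)"
    "\<psi> * \<upsilon>^2 * x2^2 + \<upsilon>^2 * x1 * x2 - \<psi>^4 * x1 * x3 =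
       \<psi>^3 * (b^2 + b - (\<upsilon> - 1) * c)"
    "\<psi> * \<upsilon>^3 * x3^2 + \<upsilon>^4 * a * x1 - \<psi>^6 * x1 * x2 =
       \<psi>^2 * \<upsilon> * ((\<upsilon> - 1) * c^2 + \<upsilon>^2 * a - \<upsilon> * (\<upsilon> - 1) * b)"
    "\<psi> * \<upsilon>^2 * x3^2 + \<upsilon>^2 * a * x1 - \<psi>^4 * x2 * x3 =
       \<psi>^2 * ((\<upsilon> - 1) * c^2 + \<upsilon> * a - (\<upsilon> - 1) * b * c)"
    unfolding x using curve i by Groebner_Basis.algebra+
  moreover have "\<psi>^2 / \<upsilon> = x1" "b * (\<psi> / \<upsilon>) = x2" "c * (\<psi>^4 / \<upsilon>^3) = x3"
    by (simp_all add: x i_def power_divide)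
  ultimately show ?thesis
    using nz inz by (simp only: Let_def kv_quadrics_symmetric_iff mult_eq_0_iff power_eq_0_iff) simp
qed

text \<open>Once \<open>x1\<close> is known to be nonzero, the relations can be divided down to two
  linear ones, which express \<open>x2\<close> and \<open>x3\<close> as fixed multiples of
  \<open>x1\<close>.\<close>

lemma skew_point_is_origin:
  fixes \<psi> \<upsilon> :: "'k::field"
  assumes curve: "\<psi>^7 = \<upsilon>^4 * (\<upsilon> - 1)" and nz: "\<psi> \<noteq> 0" "\<upsilon> \<noteq> 0"
    and q: "kv_quadrics \<psi> \<upsilon> (vec7 0 x1 x2 x3 (- x3) (- x2) (- x1))"
    and x: "vec7 0 x1 x2 x3 (- x3) (- x2) (- x1) \<noteq> 0"
  shows "proj_pt (vec7 0 x1 x2 x3 (- x3) (- x2) (- x1)) = kv_origin \<psi> \<upsilon>"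
proof -
  note eqs = kv_quadrics_skew[OF q]
  have x1: "x1 \<noteq> 0"
  proof
    assume "x1 = 0"
    then have "x3 = 0"
      using eqs(1) nz by simp
    then have "x2 = 0"
      using eqs(2) nz by simp
    with x \<open>x1 = 0\<close> \<open>x3 = 0\<close> show False
      by (simp add: vec7_eq_0_iff)
  qed
  have x32: "x3 * x2 = - (\<psi> * x1^2)"
  proof -
    have "\<upsilon>^2 * (x3 * x2 + \<psi> * x1^2) = 0"
      using eqs(3) by Groebner_Basis.algebra
    then show ?thesis
      using nz by (simp add: eq_neg_iff_add_eq_0)
  qed
  have x3: "\<upsilon> * x3 = \<psi>^2 * x1"
  proof -
    \<comment> \<open>After \<open>x3 * x2\<close> is substituted, multiplying by \<upsilon> creates
      \<open>\<upsilon>^4 * (\<upsilon> - 1)\<close>, which the curve equation replaces by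
      \<open>\<psi>^7\<close>.\<close>
    have "\<psi>^6 * x1 * (\<upsilon> * x3 - \<psi>^2 * x1) = 0"
      using eqs(4) x32 curve by Groebner_Basis.algebra
    then show ?thesis
      using nz x1 by simp
  qed
  have x2: "\<psi> * x2 = - (\<upsilon> * x1)"
  proof -
    have "\<psi> * x1 * (\<psi> * x2 + \<upsilon> * x1) = 0"
      using x32 x3 by Groebner_Basis.algebra
    then show ?thesis
      using nz x1 by (simp add: eq_neg_iff_add_eq_0)
  qed
  have "x2 = x1 * - (\<upsilon> / \<psi>)" "x3 = x1 * (\<psi>^2 / \<upsilon>)"
    using x2 x3 nz by (simp_all add: field_simps)
  then show ?thesis
    using x1 unfolding kv_origin_def Let_def proj_pt_eq_iff
    by (auto simp: smult_vec7 vec7_eq_iff intro!: exI[of _ x1])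
qed

text \<open>The cubic of the theorem, multiplied by \<open>\<upsilon>\<close>.\<close>

definition two_torsion_cubic :: "'k::field \<Rightarrow> 'k \<Rightarrow> 'k" where
  "two_torsion_cubic \<upsilon> g = \<upsilon> * g^3 + \<upsilon> * g^2 - (\<upsilon>^2 - 1) * g + (\<upsilon> - 1)^2"

text \<open>Elimination in the normalised coordinates: \<open>e3\<close> expresses \<open>c\<close>
  through \<open>b\<close>, then \<open>e2\<close> gives \<open>a\<close>, and \<open>e1\<close>
  becomes the cubic.\<close>

lemma symmetric_point_is_kv_point:
  fixes \<psi> \<upsilon> :: "'k::field"
  assumes curve: "\<psi>^7 = \<upsilon>^4 * (\<upsilon> - 1)" and nz: "\<psi> \<noteq> 0" "\<upsilon> \<noteq> 0" "\<upsilon> \<noteq> 1"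
    and q: "kv_quadrics \<psi> \<upsilon> (vec7 x0 x1 x2 x3 x3 x2 x1)"
    and x: "vec7 x0 x1 x2 x3 x3 x2 x1 \<noteq> 0"
  obtains g where "two_torsion_cubic \<upsilon> g = 0"
    and "proj_pt (vec7 x0 x1 x2 x3 x3 x2 x1) = kv_point \<psi> \<upsilon> g"
proof -
  have x1: "x1 \<noteq> 0"
  proof
    assume [simp]: "x1 = 0"
    note eqs = q[unfolded kv_quadrics_symmetric_iff]
    \<comment> \<open>With \<open>x1 = 0\<close>, suitable quadrics reduce to the squares of
      \<open>x2\<close>, \<open>x3\<close> and \<open>x0\<close> in turn.\<close>
    have "x2 = 0"
      using eqs nz by auto
    moreover from this have "x3 = 0"
      using eqs nz by auto
    moreover from this have "x0 = 0"
      using eqs nz by auto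
    ultimately show False
      using x by (simp add: vec7_eq_0_iff)
  qed
  define s where "s = \<psi>^2 / \<upsilon> / x1"
  define a b c where "a = s * x0" and "b = s * x2 / (\<psi> / \<upsilon>)" and "c = s * x3 / (\<psi>^4 / \<upsilon>^3)"
  have s: "s \<noteq> 0"
    using nz x1 by (simp add: s_def)
  have sx: "s *s vec7 x0 x1 x2 x3 x3 x2 x1 =
    (let y1 = \<psi>^2 / \<upsilon>; y2 = b * (\<psi> / \<upsilon>); y3 = c * (\<psi>^4 / \<upsilon>^3)
     in vec7 a y1 y2 y3 y3 y2 y1)"
    using nz x1 by (simp add: Let_def smult_vec7 vec7_eq_iff a_def b_def c_def s_def)
  have "kv_quadrics \<psi> \<upsilon> (s *s vec7 x0 x1 x2 x3 x3 x2 x1)"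
    using q by (rule kv_quadrics_smult)
  then have
    e1: "\<upsilon> + b * c - (\<upsilon> - 1) * c = 0" and
    e2: "b^2 + \<upsilon> * b - (\<upsilon> - 1) * a * c = 0" and
    e3: "b^2 + b - (\<upsilon> - 1) * c = 0" and
    e4: "\<upsilon>^2 + b * c - \<upsilon> * a * b = 0"
    using kv_quadrics_normalised_iff[OF curve nz(1,2), of b c a] by (simp_all add: sx Let_def)
  have b0: "b \<noteq> 0"
    using e4 nz by auto
  have b1: "b + 1 \<noteq> 0"
  proof
    assume "b + 1 = 0"
    then have "(\<upsilon> - 1) * c = 0"
      using e3 by Groebner_Basis.algebra
    then have "c = 0"
      using nz by simp
    then show False
      using e1 nz by simp
  qed
  \<comment> \<open>In \<open>kv_point\<close> the second coordinate requires
    \<open>b = (\<upsilon> - (g + 1)) / g\<close>, that is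
    \<open>b + 1 = (\<upsilon> - 1) / g\<close>; this is solved for \<open>g\<close>.\<close>
  define g where "g = (\<upsilon> - 1) / (b + 1)"
  have g0: "g \<noteq> 0" and gb: "g * (b + 1) = \<upsilon> - 1"
    using nz b1 by (simp_all add: g_def)
  have cg: "c * g = b"
  proof -
    have "(b + 1) * (c * g - b) = 0"
      using gb e3 by Groebner_Basis.algebra
    then show ?thesis
      using b1 by simp
  qed
  have a: "a = g + 1"
  proof -
    \<comment> \<open>By \<open>e3\<close>, the term \<open>(\<upsilon> - 1) * a * c\<close> in
      \<open>e2\<close> is \<open>a * b * (b + 1)\<close>, while
      \<open>(b + 1) * (g + 1) = b + \<upsilon>\<close>.\<close>
    have "b * (b + 1) * (a - (g + 1)) = 0"
      using gb e2 e3 by Groebner_Basis.algebra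
    then show ?thesis
      using b0 b1 by simp
  qed
  have b: "b = (\<upsilon> - (g + 1)) / g"
    using gb g0 by (simp add: field_simps)
  have "c = b / g"
    using cg g0 by (simp add: field_simps)
  then have c: "c = (\<upsilon> - (g + 1)) / g^2"
    by (simp add: b power2_eq_square)
  \<comment> \<open>This is \<open>e1\<close> multiplied by \<open>g^3\<close>, since
    \<open>b * g = \<upsilon> - 1 - g\<close> and \<open>c * g = b\<close>.\<close>
  have "two_torsion_cubic \<upsilon> g = 0"
    unfolding two_torsion_cubic_def using e1 cg gb by Groebner_Basis.algebra
  moreover have "proj_pt (vec7 x0 x1 x2 x3 x3 x2 x1) = proj_pt (s *s vec7 x0 x1 x2 x3 x3 x2 x1)"
    using s unfolding proj_pt_eq_iff by (auto intro!: exI[of _ "1 / s"])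
  then have "proj_pt (vec7 x0 x1 x2 x3 x3 x2 x1) = kv_point \<psi> \<upsilon> g"
    unfolding sx by (simp add: kv_point_def Let_def a b c)
  ultimately show ?thesis
    by (rule that)
qed

text \<open>The constant term of the cubic is \<open>(\<upsilon> - 1)^2\<close>.\<close>

lemma two_torsion_cubic_root_nonzero:
  assumes "two_torsion_cubic \<upsilon> g = 0" "\<upsilon> \<noteq> 1"
  shows "g \<noteq> 0"
  using assms by (auto simp: two_torsion_cubic_def)

text \<open>The elimination runs backwards: the cubic divided by \<open>g^3\<close> is one
  normalised quadric, and the other seven follow from it.\<close>

lemma kv_point_in_klein_velu:
  fixes \<psi> \<upsilon> :: "'k::field"
  assumes curve: "\<psi>^7 = \<upsilon>^4 * (\<upsilon> - 1)" and nz: "\<psi> \<noteq> 0" "\<upsilon> \<noteq> 0" "\<upsilon> \<noteq> 1"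
    and g: "two_torsion_cubic \<upsilon> g = 0"
  shows "kv_point \<psi> \<upsilon> g \<in> klein_velu \<psi> \<upsilon>"
proof -
  have g0: "g \<noteq> 0"
    using g nz(3) by (rule two_torsion_cubic_root_nonzero)
  define h where "h = 1 / g"
  have h: "h * g = 1"
    using g0 by (simp add: h_def)
  define a b c where "a = g + 1" and "b = (\<upsilon> - (g + 1)) * h" and "c = (\<upsilon> - (g + 1)) * h^2"
  note abc = a_def b_def c_def
  have bg: "b * g = \<upsilon> - (g + 1)" and cg: "c * g = b"
    using h unfolding abc by Groebner_Basis.algebra+
  have e: "\<upsilon> + b * c - (\<upsilon> - 1) * c = 0"
  proof -
    have "g^3 * (\<upsilon> + b * c - (\<upsilon> - 1) * c) = 0"
      using g bg cg unfolding two_torsion_cubic_def by Groebner_Basis.algebra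
    then show ?thesis
      using g0 by simp
  qed
  \<comment> \<open>The inverse \<open>h\<close> allows powers of \<open>g\<close> to be cancelled,
    so these are polynomial consequences of \<open>e\<close> and the relations between
    \<open>a\<close>, \<open>b\<close>, \<open>c\<close>, \<open>g\<close>.\<close>
  have "\<upsilon> * a^2 + (\<upsilon> - 1) * c^2 - (\<upsilon> - 1) * b^2 = 0"
    "\<upsilon>^2 * a^2 + (\<upsilon> - 1) * c^2 - \<upsilon>^2 * (\<upsilon> - 1) = 0"
    "\<upsilon>^2 + b * c - \<upsilon> * a * b = 0"
    "b^2 + \<upsilon> * b - (\<upsilon> - 1) * a * c = 0"
    "b^2 + b - (\<upsilon> - 1) * c = 0"
    "(\<upsilon> - 1) * c^2 + \<upsilon>^2 * a - \<upsilon> * (\<upsilon> - 1) * b = 0"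
    "(\<upsilon> - 1) * c^2 + \<upsilon> * a - (\<upsilon> - 1) * b * c = 0"
    using e bg cg h a_def by Groebner_Basis.algebra+
  with e have "let x1 = \<psi>^2 / \<upsilon>; x2 = b * (\<psi> / \<upsilon>); x3 = c * (\<psi>^4 / \<upsilon>^3)
      in kv_quadrics \<psi> \<upsilon> (vec7 a x1 x2 x3 x3 x2 x1)"
    using kv_quadrics_normalised_iff[OF curve nz(1,2), of b c a] by simp
  moreover have "(\<upsilon> - (g + 1)) / g = b" "(\<upsilon> - (g + 1)) / g^2 = c"
    by (simp_all add: abc h_def power_divide)
  ultimately show ?thesis
    using nz unfolding kv_point_def klein_velu_eq Let_def a_def[symmetric]
    by (auto simp: vec7_eq_0_iff)
qed

lemma kv_neg_kv_point: "kv_neg (kv_point \<psi> \<upsilon> g) = kv_point \<psi> \<upsilon> g"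
  by (simp add: kv_point_def Let_def kv_neg_proj_pt)

text \<open>The coordinates \<open>x1\<close> and \<open>x6\<close> are equal and nonzero on one
  side but opposite on the other.\<close>

lemma kv_point_neq_origin:
  fixes \<psi> \<upsilon> :: "'k::field"
  assumes "\<psi> \<noteq> 0" "\<upsilon> \<noteq> 0" "(2::'k) \<noteq> 0"
  shows "kv_point \<psi> \<upsilon> g \<noteq> kv_origin \<psi> \<upsilon>"
proof
  assume "kv_point \<psi> \<upsilon> g = kv_origin \<psi> \<upsilon>"
  then obtain c where "\<psi>^2 / \<upsilon> = c * 1" "\<psi>^2 / \<upsilon> = c * - 1"
    unfolding kv_point_def kv_origin_def Let_def proj_pt_eq_iff smult_vec7 vec7_eq_iff by blast
  then have "2 * (\<psi>^2 / \<upsilon>) = 0"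
    by Groebner_Basis.algebra
  then show False
    using assms by simp
qed

text \<open>The nonzero coordinate \<open>x1\<close> does not depend on the parameter, so the scalar
  is 1 and \<open>x0\<close> recovers the parameter.\<close>

lemma kv_point_inject:
  assumes "\<psi> \<noteq> 0" "\<upsilon> \<noteq> 0"
  shows "kv_point \<psi> \<upsilon> g = kv_point \<psi> \<upsilon> h \<longleftrightarrow> g = h"
proof
  assume "kv_point \<psi> \<upsilon> g = kv_point \<psi> \<upsilon> h"
  then obtain c where "g + 1 = c * (h + 1)" "\<psi>^2 / \<upsilon> = c * (\<psi>^2 / \<upsilon>)"
    by (auto simp: kv_point_def Let_def proj_pt_eq_iff smult_vec7 vec7_eq_iff)
  then show "g = h"
    using assms by simp
qed simp

lemma kv_neg_fixed_points:
  fixes \<psi> \<upsilon> :: "'k::field"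
  assumes curve: "\<psi>^7 = \<upsilon>^4 * (\<upsilon> - 1)" and nz: "\<psi> \<noteq> 0" "\<upsilon> \<noteq> 0" "\<upsilon> \<noteq> 1" "(2::'k) \<noteq> 0"
  shows "{P \<in> klein_velu \<psi> \<upsilon>. P \<noteq> kv_origin \<psi> \<upsilon> \<and> kv_neg P = P} =
    kv_point \<psi> \<upsilon> ` {g. two_torsion_cubic \<upsilon> g = 0}"
proof (intro equalityI subsetI)
  fix P
  assume "P \<in> {P \<in> klein_velu \<psi> \<upsilon>. P \<noteq> kv_origin \<psi> \<upsilon> \<and> kv_neg P = P}"
  then obtain x where P: "P = proj_pt x" "P \<noteq> kv_origin \<psi> \<upsilon>"
    and x0: "x \<noteq> 0" and q: "kv_quadrics \<psi> \<upsilon> x" and neg: "kv_neg P = P"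
    by (auto simp: klein_velu_eq)
  obtain c where rev: "reverse7 x = c *s x"
    using neg by (auto simp: P(1) kv_neg_proj_pt proj_pt_eq_iff)
  have "x = c *s (c *s x)"
    using reverse7_reverse7[of x] by (simp only: rev reverse7_smult)
  then have "(c^2 - 1) *s x = 0"
    by (simp add: vector_sub_rdistrib power2_eq_square)
  then have "c^2 - 1 = 0 \<or> x = 0"
    by (simp only: vector_mul_eq_0)
  then have "c^2 = 1"
    using x0 by simp
  then consider "c = 1" | "c = - 1"
    by (auto simp: power2_eq_1_iff)
  moreover obtain y0 y1 y2 y3 y4 y5 y6 where y: "x = vec7 y0 y1 y2 y3 y4 y5 y6"
    by (rule vec7_cases)
  ultimately show "P \<in> kv_point \<psi> \<upsilon> ` {g. two_torsion_cubic \<upsilon> g = 0}"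
  proof cases
    case 1
    have "y4 = y3 \<and> y5 = y2 \<and> y6 = y1"
      using rev unfolding y 1 reverse7_vec7 smult_vec7 vec7_eq_iff mult_1_left by blast
    then have x: "x = vec7 y0 y1 y2 y3 y3 y2 y1"
      by (simp add: y)
    show ?thesis
      using symmetric_point_is_kv_point[OF curve nz(1-3), of y0 y1 y2 y3] q x0
      unfolding P(1) x by blast
  next
    case 2
    \<comment> \<open>Reversal fixes the position of \<open>y0\<close>, so the eigenvalue -1 forces
      \<open>y0 = - y0\<close>; this is where characteristic 2 must be excluded.\<close>
    have zero: "t = 0" if "t = - t" for t :: 'k
    proof -
      have "2 * t = 0"
        using that by (metis add.right_inverse mult_2)
      then show ?thesis
        using nz(4) by simp
    qed
    have "y0 = - y0 \<and> y4 = - y3 \<and> y5 = - y2 \<and> y6 = - y1"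
      using rev unfolding y 2 reverse7_vec7 smult_vec7 vec7_eq_iff mult_minus1 by blast
    then have x: "x = vec7 0 y1 y2 y3 (- y3) (- y2) (- y1)"
      using zero[of y0] by (simp add: y)
    show ?thesis
      using skew_point_is_origin[OF curve nz(1,2)] q x0 P unfolding x by blast
  qed
next
  fix P
  assume "P \<in> kv_point \<psi> \<upsilon> ` {g. two_torsion_cubic \<upsilon> g = 0}"
  then show "P \<in> {P \<in> klein_velu \<psi> \<upsilon>. P \<noteq> kv_origin \<psi> \<upsilon> \<and> kv_neg P = P}"
    using kv_point_in_klein_velu[OF curve nz(1-3)] kv_point_neq_origin[OF nz(1,2,4)]
    by (auto simp: kv_neg_kv_point)
qed

section \<open>The function field and the two-torsion cubic\<close>

lemma field_embedding_simps:
  assumes "field_embedding \<iota>"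
  shows "\<iota> 0 = 0" "\<iota> 1 = 1" "\<iota> (numeral n) = numeral n" "\<iota> (- x) = - \<iota> x"
proof -
  have add: "\<iota> (x + y) = \<iota> x + \<iota> y" for x y
    using assms by (simp add: field_embedding_def)
  show zero: "\<iota> 0 = 0"
    using add[of 0 0] by (metis add.right_neutral add_left_cancel)
  show one: "\<iota> 1 = 1"
    using assms by (simp add: field_embedding_def)
  show "\<iota> (- x) = - \<iota> x"
    using add[of x "- x"] by (simp add: zero eq_neg_iff_add_eq_0 add.commute)
  show "\<iota> (numeral n) = numeral n"
    by (induction n) (simp_all only: numeral.simps add one)
qed

text \<open>The kernel condition on \<open>eval2\<close> is applied to \<open>curve_poly\<close>,
  which divides itself.\<close>

lemma closure_of_function_field_curve:
  assumes "closure_of_function_field \<iota> \<psi> \<upsilon>"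
  shows "\<psi>^7 = \<upsilon>^4 * (\<upsilon> - 1)"
proof -
  have "field_embedding \<iota>"
    using assms by (simp add: closure_of_function_field_def)
  note \<iota> = field_embedding_simps[OF this]
  have curve_poly: "curve_poly = [:[:0, 0, 0, 0, 1, - 1:], 0, 0, 0, 0, 0, 0, 1:]"
    by (simp add: curve_poly_def numeral_eq_Suc one_pCons)
  have "eval2 \<iota> \<psi> \<upsilon> curve_poly = \<psi>^7 - \<upsilon>^4 * (\<upsilon> - 1)"
    unfolding eval2_def curve_poly
    by (simp add: map_poly_pCons \<iota> algebra_simps numeral_eq_Suc)
  moreover have "eval2 \<iota> \<psi> \<upsilon> curve_poly = 0"
    using assms by (simp add: closure_of_function_field_def)
  ultimately show ?thesis
    by simp
qed

text \<open>A polynomial in \<upsilon> alone has degree 0 in \<psi>, so \<open>curve_poly\<close>,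
  of degree at least 7 in \<psi>, cannot divide it unless it is zero.\<close>

lemma closure_of_function_field_transcendental:
  assumes "closure_of_function_field \<iota> \<psi> \<upsilon>" "p \<noteq> 0"
  shows "poly (map_poly \<iota> p) \<upsilon> \<noteq> 0"
proof
  assume 0: "poly (map_poly \<iota> p) \<upsilon> = 0"
  have "eval2 \<iota> \<psi> \<upsilon> [:p:] = 0"
    using 0 by (simp add: eval2_def map_poly_pCons)
  then have "curve_poly dvd [:p:]"
    using assms(1) by (simp add: closure_of_function_field_def)
  then have "degree curve_poly \<le> degree [:p:]"
    using assms(2) by (intro dvd_imp_degree_le) auto
  moreover have "poly.coeff curve_poly 7 = 1"
    by (simp add: curve_poly_def numeral_eq_Suc)
  then have "degree curve_poly \<ge> 7"
    by (intro le_degree) simp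
  ultimately show False
    by simp
qed

text \<open>The hypotheses are Vieta's relations for roots \<open>g\<close>, \<open>g\<close>,
  \<open>h\<close>, cleared of denominators. A double root kills the discriminant.\<close>

lemma two_torsion_cubic_double_root:
  fixes \<upsilon> :: "'k::field"
  assumes "2 * g + h = - 1" "\<upsilon> * (g^2 + 2 * g * h) = - (\<upsilon>^2 - 1)" "\<upsilon> * (g^2 * h) = - ((\<upsilon> - 1)^2)"
  shows "4 * (\<upsilon> - 1)^3 * (\<upsilon>^3 - 8 * \<upsilon>^2 + 5 * \<upsilon> + 1) = 0"
proof -
  \<comment> \<open>the discriminant of \<open>(T - g)\<^sup>2 (T - h)\<close>, times \<open>\<upsilon>\<^sup>3\<close>\<close>
  have "\<upsilon> * (\<upsilon> * (g^2 + 2 * g * h))^2 - 4 * (\<upsilon> * (g^2 + 2 * g * h))^3 + 4 * \<upsilon>^2 * (\<upsilon> * (g^2 * h))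
      - 27 * \<upsilon> * (\<upsilon> * (g^2 * h))^2 - 18 * \<upsilon> * (\<upsilon> * (g^2 + 2 * g * h)) * (\<upsilon> * (g^2 * h)) = 0"
  proof -
    have h: "h = - 1 - 2 * g"
      using assms(1) by Groebner_Basis.algebra
    show ?thesis
      unfolding h by Groebner_Basis.algebra
  qed
  \<comment> \<open>The discriminant was grouped so that the left sides of Vieta's relations occur
    in it literally and can be rewritten.\<close>
  then show ?thesis
    unfolding assms(2,3) by Groebner_Basis.algebra
qed

text \<open>A self-inverse element has order dividing the prime 2, and order 1 means the
  identity.\<close>

lemma (in group) ord_eq_2_iff:
  assumes "x \<in> carrier G"
  shows "ord x = 2 \<longleftrightarrow> x \<noteq> \<one> \<and> inv x = x"
proof -
  have "inv x = x \<longleftrightarrow> x \<otimes> x = \<one>"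
    using assms by (metis inv_equality r_inv)
  also have "\<dots> \<longleftrightarrow> ord x dvd 2"
    using assms pow_eq_id[of x 2] by (simp add: numeral_2_eq_2)
  also have "\<dots> \<longleftrightarrow> ord x = 1 \<or> ord x = 2"
    using prime_nat_iff two_is_prime_nat by auto
  finally show ?thesis
    using assms ord_eq_1 by auto
qed

theorem theorem4p2:
  fixes \<iota> :: "complex \<Rightarrow> 'k::alg_closed_field"
    and \<psi> \<upsilon> g1 g2 g3 :: 'k
    and G :: "('k ^ 7) set monoid"
  assumes "closure_of_function_field \<iota> \<psi> \<upsilon>"
    and "kv_group_law \<psi> \<upsilon> G"
    and "[: (\<upsilon> - 1)^2 / \<upsilon>, - ((\<upsilon>^2 - 1) / \<upsilon>), 1, 1 :] = [:- g1, 1:] * [:- g2, 1:] * [:- g3, 1:]"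
  shows "{P \<in> carrier G. group.ord G P = 2} =
           {kv_point \<psi> \<upsilon> g1, kv_point \<psi> \<upsilon> g2, kv_point \<psi> \<upsilon> g3} \<and>
         distinct [kv_point \<psi> \<upsilon> g1, kv_point \<psi> \<upsilon> g2, kv_point \<psi> \<upsilon> g3]"
proof -
  have emb: "field_embedding \<iota>"
    using assms(1) by (simp add: closure_of_function_field_def)
  note \<iota> = field_embedding_simps[OF emb]
  note trans = closure_of_function_field_transcendental[OF assms(1)]
  have curve: "\<psi>^7 = \<upsilon>^4 * (\<upsilon> - 1)"
    using assms(1) by (rule closure_of_function_field_curve)
  \<comment> \<open>Transcendence of \<upsilon> is applied to the polynomials \<open>2\<close>,
    \<open>U\<close> and \<open>U - 1\<close>.\<close>
  have two: "(2::'k) \<noteq> 0" and \<upsilon>: "\<upsilon> \<noteq> 0" "\<upsilon> \<noteq> 1"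
    using trans[of "[:2:]"] trans[of "[:0, 1:]"] trans[of "[:- 1, 1:]"]
    by (simp_all add: map_poly_pCons \<iota>)
  \<comment> \<open>The remaining factor of the discriminant, again a nonzero polynomial in
    \<upsilon>.\<close>
  have disc: "\<upsilon>^3 - 8 * \<upsilon>^2 + 5 * \<upsilon> + 1 \<noteq> 0"
    using trans[of "[:1, 5, - 8, 1:]"]
    by (simp add: map_poly_pCons \<iota> algebra_simps power2_eq_square power3_eq_cube)
  have \<psi>: "\<psi> \<noteq> 0"
    using curve \<upsilon> by auto
  have vieta: "g1 + g2 + g3 = - 1" "\<upsilon> * (g1 * g2 + g1 * g3 + g2 * g3) = - (\<upsilon>^2 - 1)"
    "\<upsilon> * (g1 * g2 * g3) = - ((\<upsilon> - 1)^2)"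
  proof -
    have c: "1 = - (g1 + g2 + g3)" "- ((\<upsilon>^2 - 1) / \<upsilon>) = g1 * g2 + g1 * g3 + g2 * g3"
      "(\<upsilon> - 1)^2 / \<upsilon> = - (g1 * g2 * g3)"
      using assms(3) by (simp_all add: algebra_simps)
    show "g1 + g2 + g3 = - 1"
      using c(1) by Groebner_Basis.algebra
    show "\<upsilon> * (g1 * g2 + g1 * g3 + g2 * g3) = - (\<upsilon>^2 - 1)"
      unfolding c(2)[symmetric] using \<upsilon>(1) by simp
    have "\<upsilon> * - (g1 * g2 * g3) = (\<upsilon> - 1)^2"
      unfolding c(3)[symmetric] using \<upsilon>(1) by simp
    then show "\<upsilon> * (g1 * g2 * g3) = - ((\<upsilon> - 1)^2)"
      by Groebner_Basis.algebra
  qed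
  have "two_torsion_cubic \<upsilon> g = \<upsilon> * ((g - g1) * (g - g2) * (g - g3))" for g
    unfolding two_torsion_cubic_def using vieta by Groebner_Basis.algebra
  then have roots: "{g. two_torsion_cubic \<upsilon> g = 0} = {g1, g2, g3}"
    using \<upsilon>(1) by auto
  have no_double: False
    if "2 * g + h = - 1" "\<upsilon> * (g^2 + 2 * g * h) = - (\<upsilon>^2 - 1)"
      "\<upsilon> * (g^2 * h) = - ((\<upsilon> - 1)^2)" for g h
  proof -
    \<comment> \<open>The constant 4 is split as \<open>2 * 2\<close> so that \<open>two\<close>
      rules it out as a zero factor.\<close>
    have "2 * 2 * (\<upsilon> - 1)^3 * (\<upsilon>^3 - 8 * \<upsilon>^2 + 5 * \<upsilon> + 1) = 0"
      using two_torsion_cubic_double_root[OF that] by simp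
    then show False
      using two \<upsilon> disc by (simp only: mult_eq_0_iff power_eq_0_iff) simp
  qed
  \<comment> \<open>In each instance of \<open>no_double\<close> the first argument is the repeated
    root and the second is the remaining one.\<close>
  have distinct: "g1 \<noteq> g2" "g1 \<noteq> g3" "g2 \<noteq> g3"
    using no_double[of g1 g3] no_double[of g1 g2] no_double[of g2 g1] vieta
    by (auto simp: algebra_simps power2_eq_square)
  have group: "group G" "carrier G = klein_velu \<psi> \<upsilon>" "\<one>\<^bsub>G\<^esub> = kv_origin \<psi> \<upsilon>"
    "\<And>P. P \<in> carrier G \<Longrightarrow> inv\<^bsub>G\<^esub> P = kv_neg P"
    using assms(2) by (auto simp: kv_group_law_def comm_group_def)
  have "{P \<in> carrier G. group.ord G P = 2} =
      {P \<in> klein_velu \<psi> \<upsilon>. P \<noteq> kv_origin \<psi> \<upsilon> \<and> kv_neg P = P}"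
    using group.ord_eq_2_iff[OF group(1)] group(2-4) by auto
  also have "\<dots> = {kv_point \<psi> \<upsilon> g1, kv_point \<psi> \<upsilon> g2, kv_point \<psi> \<upsilon> g3}"
    using kv_neg_fixed_points[OF curve \<psi> \<upsilon> two] by (simp add: roots)
  finally show ?thesis
    using distinct by (simp add: kv_point_inject[OF \<psi> \<upsilon>(1)])
qed

end
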